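(* Let $(X,\rho)$ be a partial metric space, let $\lambda=(\lambda_n)\in\Lambda$, and let $\alpha\in(0,1]$. If $\liminf_{n\to\infty}\frac{\lambda_n^\alpha}{n^\alpha}>0$, then $S_\rho^\alpha(X)\subseteq S_\rho^\alpha(\lambda,X)$.
   Context: A partial metric on a non-empty set $X$ is a function $\rho:X\times X\to\mathbb{R}$ such that for all $x,y,z\in X$: (i) $0\le\rho(x,x)\le\rho(x,y)$; (ii) if $\rho(x,x)=\rho(x,y)=\rho(y,y)$ then $x=y$; (iii) $\rho(x,y)=\rho(y,x)$; (iv) $\rho(x,z)\le\rho(x,y)+\rho(y,z)-\rho(y,y)$. The pair $(X,\rho)$ is called a partial metric space. Sequences are indexed by $\mathbb{N}=\{1,2,3,\dots\}$. $\Lambda$ is the class of all non-decreasing sequences $\lambda=(\lambda_n)$ of positive real numbers tending to $\infty$ with $\lambda_1=1$ and $\lambda_{n+1}\le\lambda_n+1$ for all $n$. For $\lambda\in\Lambda$, $I_n=[n-\lambda_n+1,n]$, and $k\in I_n$ means that $k$ is an integer in this interval. Let $\alpha\in(0,1]$; $|\cdot|$ of a set denotes its cardinality. A sequence $(x_k)$ in $X$ is $\rho$-statistically convergent of order $\alpha$ to $x\in X$ if for every $\varepsilon>0$, $\lim_{n\to\infty}\frac{1}{n^\alpha}\left|\{k\le n:|\rho(x_k,x)-\rho(x,x)|\ge\varepsilon\}\right|=0$; $S_\rho^\alpha(X)$ is the set of all sequences in $X$ for which this holds for some $x\in X$. A sequence $(x_k)$ in $X$ is $\lambda\rho$-statistically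 convergent of order $\alpha$ to $x\in X$ if for every $\varepsilon>0$, $\lim_{n\to\infty}\frac{1}{\lambda_n^\alpha}\left|\{k\in I_n:|\rho(x_k,x)-\rho(x,x)|\ge\varepsilon\}\right|=0$; $S_\rho^\alpha(\lambda,X)$ is the set of all sequences in $X$ for which this holds for some $x\in X$. *)

theory Defs
  imports Complex_Main "HOL-Library.FuncSet" "HOL-Library.Extended_Real"
begin

definition partial_metric_on :: "'a set \<Rightarrow> ('a \<Rightarrow> 'a \<Rightarrow> real) \<Rightarrow> bool" where
  "partial_metric_on X \<rho> \<longleftrightarrow>
     X \<noteq> {} \<and>
     (\<forall>x\<in>X. \<forall>y\<in>X. 0 \<le> \<rho> x x \<and> \<rho> x x \<le> \<rho> x y) \<and>
     (\<forall>x\<in>X. \<forall>y\<in>X. \<rho> x x = \<rho> x y \<and> \<rho> x y = \<rho> y y \<longrightarrow> x = y) \<and>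
     (\<forall>x\<in>X. \<forall>y\<in>X. \<rho> x y = \<rho> y x) \<and>
     (\<forall>x\<in>X. \<forall>y\<in>X. \<forall>z\<in>X. \<rho> x z \<le> \<rho> x y + \<rho> y z - \<rho> y y)"

text \<open>
  Sequences are indexed by the positive integers: a real sequence is a function on
  \<open>nat\<close> whose value at \<open>0\<close> is never used, and a sequence in \<open>X\<close> is an element of
  \<open>{1..} \<rightarrow>\<^sub>E X\<close>, so that its value at \<open>0\<close> is the fixed dummy \<open>undefined\<close>.
\<close>

definition Lambda_class :: "(nat \<Rightarrow> real) set" where
  "Lambda_class = {l.
     (\<forall>n\<ge>1. 0 < l n) \<and>
     (\<forall>n\<ge>1. l n \<le> l (n + 1)) \<and>
     filterlim l at_top sequentially \<and>
     l 1 = 1 \<and>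
     (\<forall>n\<ge>1. l (n + 1) \<le> l n + 1)}"

text \<open>
  The integers in the interval from \<open>n - l n + 1\<close> to \<open>n\<close>.  For \<open>l\<close> in \<open>Lambda_class\<close>
  and \<open>n \<ge> 1\<close> one has \<open>l n \<le> n\<close>, so these integers are all positive and nothing is
  lost by letting \<open>k\<close> range over \<open>nat\<close>.
\<close>

definition lam_interval :: "(nat \<Rightarrow> real) \<Rightarrow> nat \<Rightarrow> nat set" where
  "lam_interval l n = {k. real n - l n + 1 \<le> real k \<and> real k \<le> real n}"

definition stat_conv_to ::
    "('a \<Rightarrow> 'a \<Rightarrow> real) \<Rightarrow> real \<Rightarrow> (nat \<Rightarrow> 'a) \<Rightarrow> 'a \<Rightarrow> bool" where
  "stat_conv_to \<rho> \<alpha> s x \<longleftrightarrow>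
     (\<forall>\<epsilon>>0. (\<lambda>n. 1 / real n powr \<alpha> *
                 real (card {k \<in> {1..n}. \<bar>\<rho> (s k) x - \<rho> x x\<bar> \<ge> \<epsilon>}))
              \<longlonglongrightarrow> 0)"

definition lam_stat_conv_to ::
    "('a \<Rightarrow> 'a \<Rightarrow> real) \<Rightarrow> real \<Rightarrow> (nat \<Rightarrow> real) \<Rightarrow> (nat \<Rightarrow> 'a) \<Rightarrow> 'a \<Rightarrow> bool" where
  "lam_stat_conv_to \<rho> \<alpha> l s x \<longleftrightarrow>
     (\<forall>\<epsilon>>0. (\<lambda>n. 1 / l n powr \<alpha> *
                 real (card {k \<in> lam_interval l n. \<bar>\<rho> (s k) x - \<rho> x x\<bar> \<ge> \<epsilon>}))
              \<longlonglongrightarrow> 0)"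

definition S_space :: "('a \<Rightarrow> 'a \<Rightarrow> real) \<Rightarrow> real \<Rightarrow> 'a set \<Rightarrow> (nat \<Rightarrow> 'a) set" where
  "S_space \<rho> \<alpha> X = {s \<in> {1..} \<rightarrow>\<^sub>E X. \<exists>x\<in>X. stat_conv_to \<rho> \<alpha> s x}"

definition S_lam_space ::
    "('a \<Rightarrow> 'a \<Rightarrow> real) \<Rightarrow> real \<Rightarrow> (nat \<Rightarrow> real) \<Rightarrow> 'a set \<Rightarrow> (nat \<Rightarrow> 'a) set" where
  "S_lam_space \<rho> \<alpha> l X = {s \<in> {1..} \<rightarrow>\<^sub>E X. \<exists>x\<in>X. lam_stat_conv_to \<rho> \<alpha> l s x}"

end

theory Submission
  imports Defs
begin

text \<open>
  Since \<open>l\<close> starts at \<open>1\<close> and grows by at most \<open>1\<close> per step, \<open>l n \<le> n\<close>, so the window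
  \<open>lam_interval l n\<close> lies inside \<open>{1..n}\<close> and contains at most as many exceptional
  indices as \<open>{1..n}\<close> does.  The liminf condition supplies a constant \<open>c > 0\<close> with
  \<open>c * n powr \<alpha> \<le> l n powr \<alpha>\<close> for all large \<open>n\<close>; hence the normalised count over the window
  is at most \<open>1 / c\<close> times the normalised count over \<open>{1..n}\<close>, and it tends to \<open>0\<close> whenever
  the latter does.  The limit point is the same for both notions of convergence.
\<close>

lemma Lambda_class_le_index:
  assumes "l \<in> Lambda_class" and "1 \<le> n"
  shows "l n \<le> real n"
  using assms(2)
proof (induction n rule: dec_induct)
  case base
  then show ?case using assms(1) by (simp add: Lambda_class_def)
next
  case (step n)
  have "l (n + 1) \<le> l n + 1"
    using assms(1) step.hyps by (simp add: Lambda_class_def)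
  then show ?case using step.IH by simp
qed

lemma lam_interval_subset:
  assumes "l \<in> Lambda_class" and "1 \<le> n"
  shows "lam_interval l n \<subseteq> {1..n}"
  using Lambda_class_le_index[OF assms] by (auto simp: lam_interval_def)

lemma liminf_pos_eventually_bounded_below:
  fixes f :: "nat \<Rightarrow> real"
  assumes "liminf (\<lambda>n. ereal (f n)) > 0"
  obtains c where "0 < c" and "\<forall>\<^sub>F n in sequentially. c < f n"
proof -
  \<comment> \<open>The liminf may be infinite, so a real number strictly below it is chosen.\<close>
  obtain c where "0 < ereal c" and c: "ereal c < liminf (\<lambda>n. ereal (f n))"
    using ereal_dense2[OF assms] by blast
  moreover have "\<forall>\<^sub>F n in sequentially. c < f n"
    using less_LiminfD[OF c] by simp
  ultimately show thesis using that by simp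
qed

lemma stat_conv_to_imp_lam_stat_conv_to:
  assumes l: "l \<in> Lambda_class"
    and liminf: "liminf (\<lambda>n. ereal (l n powr \<alpha> / real n powr \<alpha>)) > 0"
    and conv: "stat_conv_to \<rho> \<alpha> s x"
  shows "lam_stat_conv_to \<rho> \<alpha> l s x"
  unfolding lam_stat_conv_to_def
proof (intro allI impI)
  fix \<epsilon> :: real assume "\<epsilon> > 0"
  define bad where "bad A = {k \<in> A. \<bar>\<rho> (s k) x - \<rho> x x\<bar> \<ge> \<epsilon>}" for A
  obtain c where c: "0 < c" "\<forall>\<^sub>F n in sequentially. c < l n powr \<alpha> / real n powr \<alpha>"
    using liminf_pos_eventually_bounded_below[OF liminf] .
  have "(\<lambda>n. 1 / real n powr \<alpha> * real (card (bad {1..n}))) \<longlonglongrightarrow> 0"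
    using conv \<open>\<epsilon> > 0\<close> by (simp add: stat_conv_to_def bad_def)
  then have lim: "(\<lambda>n. 1 / c * (1 / real n powr \<alpha> * real (card (bad {1..n})))) \<longlonglongrightarrow> 0"
    by (rule tendsto_mult_right_zero)
  have "\<forall>\<^sub>F n in sequentially. 1 / l n powr \<alpha> * real (card (bad (lam_interval l n)))
          \<le> 1 / c * (1 / real n powr \<alpha> * real (card (bad {1..n})))"
    using c(2) eventually_ge_at_top[of 1]
  proof eventually_elim
    case (elim n)
    have "bad (lam_interval l n) \<subseteq> bad {1..n}"
      using lam_interval_subset[OF l elim(2)] by (auto simp: bad_def)
    then have card: "card (bad (lam_interval l n)) \<le> card (bad {1..n})"
      by (intro card_mono) (simp_all add: bad_def)
    have pos: "0 < real n powr \<alpha>" using elim(2) by simp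
    then have "c * real n powr \<alpha> \<le> l n powr \<alpha>"
      using elim(1) by (simp add: pos_less_divide_eq less_imp_le)
    then have "1 / l n powr \<alpha> \<le> 1 / (c * real n powr \<alpha>)"
      using pos c(1) by (intro frac_le) simp_all
    then have "1 / l n powr \<alpha> * real (card (bad (lam_interval l n)))
        \<le> 1 / (c * real n powr \<alpha>) * real (card (bad {1..n}))"
      using card pos c(1) by (intro mult_mono) auto
    then show ?case by simp
  qed
  then show "(\<lambda>n. 1 / l n powr \<alpha> *
      real (card {k \<in> lam_interval l n. \<bar>\<rho> (s k) x - \<rho> x x\<bar> \<ge> \<epsilon>})) \<longlonglongrightarrow> 0"
    unfolding bad_def[symmetric]
    by (intro tendsto_sandwich[OF _ _ tendsto_const lim]) simp_all
qed

theorem theorem3p5: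
  fixes X :: "'a set" and \<rho> :: "'a \<Rightarrow> 'a \<Rightarrow> real"
    and l :: "nat \<Rightarrow> real" and \<alpha> :: real
  assumes "partial_metric_on X \<rho>"
    and "l \<in> Lambda_class"
    and "0 < \<alpha>" and "\<alpha> \<le> 1"
    and "liminf (\<lambda>n. ereal (l n powr \<alpha> / real n powr \<alpha>)) > 0"
  shows "S_space \<rho> \<alpha> X \<subseteq> S_lam_space \<rho> \<alpha> l X"
proof
  fix s assume "s \<in> S_space \<rho> \<alpha> X"
  then obtain x where "s \<in> {1..} \<rightarrow>\<^sub>E X" and "x \<in> X" and "stat_conv_to \<rho> \<alpha> s x"
    unfolding S_space_def by blast
  moreover from this(3) have "lam_stat_conv_to \<rho> \<alpha> l s x"
    by (rule stat_conv_to_imp_lam_stat_conv_to[OF assms(2,5)])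
  ultimately show "s \<in> S_lam_space \<rho> \<alpha> l X"
    unfolding S_lam_space_def by blast
qed

end
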